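(* Let $\mathcal{U},\mathcal{Y}$ be Hilbert spaces, $\mathcal{F}$ a closed subspace of $\mathcal{U}$, and $\omega=\begin{pmatrix}\omega_1\\ \omega_2\end{pmatrix}:\mathcal{F}\to\mathcal{Y}\oplus\mathcal{U}$ a contraction. Then there exists a unique solution to the $H^2$ interpolation problem defined by $\omega$ if and only if one of the following holds: (i) $\mathcal{F}=\mathcal{U}$; (ii) the operator $\omega_1(\Pi_{\mathcal{F}}\omega_2)^n:\mathcal{F}\to\mathcal{Y}$ is a co-isometry for every $n=0,1,2,\ldots$.
   Context: $\Pi_{\mathcal{F}}:\mathcal{U}\to\mathcal{F}$ is the orthogonal projection. $\mathfrak{H}^2(\mathcal{U},\mathcal{Y})$ denotes the set of functions $H$ on the open unit disc $\mathbb{D}$ with values bounded operators $\mathcal{U}\to\mathcal{Y}$ such that $(\Gamma_Hu)(\lambda)=H(\lambda)u$ defines a bounded operator $\Gamma_H:\mathcal{U}\to H^2(\mathcal{Y})$ (the $\mathcal{Y}$-valued Hardy space); it is normed by $\|H\|=\|\Gamma_H\|$, and $\mathfrak{H}^2_{\mathrm{ball}}(\mathcal{U},\mathcal{Y})$ is its closed unit ball. A solution to the $H^2$ interpolation problem defined by $\omega$ is a function $H\in\mathfrak{H}^2_{\mathrm{ball}}(\mathcal{U},\mathcal{Y})$ with $\omega_1+\lambda H(\lambda)\omega_2=H(\lambda)|_{\mathcal{F}}$ for all $\lambda\in\mathbb{D}$. *)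

theory Defs
  imports "HOL-Analysis.Analysis"
begin

class complex_vector = real_vector +
  fixes scaleC :: "complex \<Rightarrow> 'a \<Rightarrow> 'a" (infixr \<open>*\<^sub>C\<close> 75)
  assumes scaleC_add_right: "a *\<^sub>C (x + y) = a *\<^sub>C x + a *\<^sub>C y"
    and scaleC_add_left: "(a + b) *\<^sub>C x = a *\<^sub>C x + b *\<^sub>C x"
    and scaleC_scaleC: "a *\<^sub>C (b *\<^sub>C x) = (a * b) *\<^sub>C x"
    and scaleC_one: "1 *\<^sub>C x = x"
    and scaleC_of_real: "complex_of_real r *\<^sub>C x = r *\<^sub>R x"

class complex_inner = complex_vector + real_normed_vector +
  fixes cinner :: "'a \<Rightarrow> 'a \<Rightarrow> complex"
  assumes cinner_commute: "cinner x y = cnj (cinner y x)"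
    and cinner_add_right: "cinner x (y + z) = cinner x y + cinner x z"
    and cinner_scaleC_right: "cinner x (a *\<^sub>C y) = a * cinner x y"
    and cinner_ge_zero: "0 \<le> Re (cinner x x) \<and> Im (cinner x x) = 0"
    and cinner_eq_zero_iff: "cinner x x = 0 \<longleftrightarrow> x = 0"
    and norm_eq_sqrt_cinner: "norm x = sqrt (Re (cinner x x))"

class chilbert_space = complex_inner + complete_space

definition csubspace :: "'a::complex_vector set \<Rightarrow> bool" where
  "csubspace S \<longleftrightarrow> 0 \<in> S \<and> (\<forall>x\<in>S. \<forall>y\<in>S. x + y \<in> S) \<and> (\<forall>a. \<forall>x\<in>S. a *\<^sub>C x \<in> S)"

definition closed_csubspace :: "'a::complex_inner set \<Rightarrow> bool" where
  "closed_csubspace S \<longleftrightarrow> csubspace S \<and> closed S"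

text \<open>Complex-linear maps defined on a subspace \<open>S\<close> (values off \<open>S\<close> are irrelevant).\<close>
definition clinear_on :: "'a::complex_vector set \<Rightarrow> ('a \<Rightarrow> 'b::complex_vector) \<Rightarrow> bool" where
  "clinear_on S A \<longleftrightarrow> (\<forall>x\<in>S. \<forall>y\<in>S. A (x + y) = A x + A y) \<and> (\<forall>a. \<forall>x\<in>S. A (a *\<^sub>C x) = a *\<^sub>C A x)"

definition bounded_clinear :: "('a::complex_inner \<Rightarrow> 'b::complex_inner) \<Rightarrow> bool" where
  "bounded_clinear A \<longleftrightarrow> clinear_on UNIV A \<and> (\<exists>K. \<forall>x. norm (A x) \<le> K * norm x)"

definition orth_proj :: "'a::complex_inner set \<Rightarrow> 'a \<Rightarrow> 'a" where
  "orth_proj F x = (THE y. y \<in> F \<and> (\<forall>z\<in>F. cinner z (x - y) = 0))"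

definition coisometry_on :: "'a::complex_inner set \<Rightarrow> ('a \<Rightarrow> 'b::complex_inner) \<Rightarrow> bool" where
  "coisometry_on F A \<longleftrightarrow>
     (\<exists>B. (\<forall>y. B y \<in> F) \<and> (\<forall>x\<in>F. \<forall>y. cinner (A x) y = cinner x (B y)) \<and> (\<forall>y. A (B y) = y))"

definition H2_coeffs :: "(complex \<Rightarrow> 'y::complex_inner) \<Rightarrow> (nat \<Rightarrow> 'y) \<Rightarrow> bool" where
  "H2_coeffs f a \<longleftrightarrow> summable (\<lambda>n. (norm (a n))\<^sup>2) \<and>
     (\<forall>z. cmod z < 1 \<longrightarrow> (\<lambda>n. (z ^ n) *\<^sub>C a n) sums f z)"

definition hardy2 :: "(complex \<Rightarrow> 'y::complex_inner) set" where
  "hardy2 = {f. \<exists>a. H2_coeffs f a}"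

definition hardy2_norm :: "(complex \<Rightarrow> 'y::complex_inner) \<Rightarrow> real" where
  "hardy2_norm f = sqrt (\<Sum>n. (norm ((SOME a. H2_coeffs f a) n))\<^sup>2)"

text \<open>The closed unit ball of \<open>\<frak>H\<^sup>2(U,Y)\<close>: \<open>H(\<lambda>)\<close> is a bounded operator for every
  \<open>\<lambda>\<close> in the disc, \<open>\<Gamma>\<^sub>H u = H(\<cdot>) u\<close> maps into \<open>H\<^sup>2(Y)\<close> and \<open>\<parallel>\<Gamma>\<^sub>H\<parallel> \<le> 1\<close>
  (linearity of \<open>\<Gamma>\<^sub>H\<close> is automatic).\<close>
definition H2_ball :: "(complex \<Rightarrow> 'u::complex_inner \<Rightarrow> 'y::complex_inner) set" where
  "H2_ball = {H. (\<forall>z. cmod z < 1 \<longrightarrow> bounded_clinear (H z)) \<and>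
                 (\<forall>u. (\<lambda>z. H z u) \<in> hardy2 \<and> hardy2_norm (\<lambda>z. H z u) \<le> norm u)}"

definition H2_interp_solution ::
  "'u::complex_inner set \<Rightarrow> ('u \<Rightarrow> 'y::complex_inner) \<Rightarrow> ('u \<Rightarrow> 'u) \<Rightarrow> (complex \<Rightarrow> 'u \<Rightarrow> 'y) \<Rightarrow> bool" where
  "H2_interp_solution F \<omega>1 \<omega>2 H \<longleftrightarrow> H \<in> H2_ball \<and>
     (\<forall>z. cmod z < 1 \<longrightarrow> (\<forall>x\<in>F. \<omega>1 x + z *\<^sub>C H z (\<omega>2 x) = H z x))"

end

theory Submission
  imports Defs
begin

text \<open>A solution is determined by its Taylor coefficients \<open>H\<^sub>n\<close>, and the interpolation condition says
  \<open>H\<^sub>0 = \<omega>1\<close> and \<open>H\<^sub>n\<^sub>+\<^sub>1 = H\<^sub>n \<omega>2\<close> on \<open>F\<close>. If the operators \<open>\<omega>1 (\<Pi> \<omega>2)\<^sup>n\<close> are co-isometries, then,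
  inductively, \<open>H\<^sub>n\<close> is a contraction extending one of them, so it vanishes on the
  orthogonal complement of \<open>F\<close> and is determined.
  Conversely, every contractive extension \<open>(C1, C2)\<close> of \<open>\<omega>\<close> to the whole space gives the solution
  \<open>H\<^sub>n = C1 C2\<^sup>n\<close>. For \<open>F\<close> proper, \<open>\<omega> \<Pi>\<close> may be perturbed in a direction orthogonal to \<open>F\<close> by any small
  vector in the range of \<open>I - \<omega> \<omega>\<^sup>*\<close>; if none of these perturbations changes the coefficients, then
  \<open>\<omega>1 \<omega>1\<^sup>* = I\<close> and \<open>A\<^sub>n\<^sub>+\<^sub>1 \<omega>2\<^sup>* = A\<^sub>n \<Pi>\<close> for \<open>A\<^sub>n = \<omega>1 (\<Pi> \<omega>2)\<^sup>n\<close>, and hence all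
  \<open>A\<^sub>n\<close> are co-isometries.\<close>

section \<open>Complex inner product spaces\<close>

\<comment> \<open>Makes the convergence tests for series in Banach spaces applicable to power series
  with values in a Hilbert space.\<close>
subclass (in chilbert_space) banach ..

lemma scaleC_zero_left [simp]: "0 *\<^sub>C (x::'a::complex_vector) = 0"
  using scaleC_add_left[of 0 0 x] by simp

lemma scaleC_zero_right [simp]: "a *\<^sub>C (0::'a::complex_vector) = 0"
  using scaleC_add_right[of a 0 "0::'a"] by simp

lemma scaleC_minus_left: "(- a) *\<^sub>C (x::'a::complex_vector) = - (a *\<^sub>C x)"
  using scaleC_add_left[of a "-a" x] by (simp add: add_eq_0_iff)

lemma scaleC_minus1 [simp]: "(-1) *\<^sub>C (x::'a::complex_vector) = - x"
  using scaleC_minus_left[of 1 x] by (simp add: scaleC_one)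

lemma scaleC_minus_right: "a *\<^sub>C (- x::'a::complex_vector) = - (a *\<^sub>C x)"
  using scaleC_add_right[of a x "-x"] by (simp add: add_eq_0_iff)

lemma scaleC_diff_right: "a *\<^sub>C (x - y::'a::complex_vector) = a *\<^sub>C x - a *\<^sub>C y"
  using scaleC_add_right[of a x "-y"] by (simp add: scaleC_minus_right)

lemma scaleR_eq_scaleC: "r *\<^sub>R (x::'a::complex_vector) = complex_of_real r *\<^sub>C x"
  by (simp add: scaleC_of_real)

lemma scaleC_scaleR: "a *\<^sub>C (r *\<^sub>R (x::'a::complex_vector)) = r *\<^sub>R (a *\<^sub>C x)"
  by (simp add: scaleR_eq_scaleC scaleC_scaleC mult.commute)

lemma cinner_zero_right [simp]: "cinner (x::'a::complex_inner) 0 = 0"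
  using cinner_add_right[of x 0 0] by simp

lemma cinner_zero_left [simp]: "cinner 0 (x::'a::complex_inner) = 0"
  using cinner_commute[of 0 x] by simp

lemma cinner_minus_right: "cinner (x::'a::complex_inner) (- y) = - cinner x y"
  using cinner_add_right[of x y "-y"] by (simp add: add_eq_0_iff)

lemma cinner_diff_right: "cinner (x::'a::complex_inner) (y - z) = cinner x y - cinner x z"
  using cinner_add_right[of x y "-z"] by (simp add: cinner_minus_right)

lemma cinner_add_left: "cinner (x + y::'a::complex_inner) z = cinner x z + cinner y z"
  using cinner_commute[of "x+y" z] cinner_commute[of x z] cinner_commute[of y z]
  by (simp add: cinner_add_right)

lemma cinner_diff_left: "cinner (x - y::'a::complex_inner) z = cinner x z - cinner y z"
  using cinner_commute[of "x-y" z] cinner_commute[of x z] cinner_commute[of y z]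
  by (simp add: cinner_diff_right)

lemma cinner_scaleC_left: "cinner (a *\<^sub>C x::'a::complex_inner) y = cnj a * cinner x y"
  using cinner_commute[of "a *\<^sub>C x" y] cinner_commute[of x y] by (simp add: cinner_scaleC_right)

lemma cinner_scaleR_right: "cinner (x::'a::complex_inner) (r *\<^sub>R y) = of_real r * cinner x y"
  by (simp add: scaleR_eq_scaleC cinner_scaleC_right)

lemma norm_sq_eq_cinner: "(norm (x::'a::complex_inner))\<^sup>2 = Re (cinner x x)"
  using cinner_ge_zero[of x] by (simp add: norm_eq_sqrt_cinner)

lemma cinner_self: "cinner (x::'a::complex_inner) x = of_real ((norm x)\<^sup>2)"
  using cinner_ge_zero[of x] by (simp add: complex_eq_iff norm_sq_eq_cinner)

lemma Re_cinner_commute: "Re (cinner y (x::'a::complex_inner)) = Re (cinner x y)"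
  using cinner_commute[of y x] by simp

lemma norm_add_sq: "(norm (x + y::'a::complex_inner))\<^sup>2 = (norm x)\<^sup>2 + 2 * Re (cinner x y) + (norm y)\<^sup>2"
  by (simp add: norm_sq_eq_cinner cinner_add_left cinner_add_right Re_cinner_commute[of y x])

lemma norm_diff_sq: "(norm (x - y::'a::complex_inner))\<^sup>2 = (norm x)\<^sup>2 - 2 * Re (cinner x y) + (norm y)\<^sup>2"
  by (simp add: norm_sq_eq_cinner cinner_diff_left cinner_diff_right Re_cinner_commute[of y x])

lemma norm_scaleC: "norm (a *\<^sub>C (x::'a::complex_inner)) = cmod a * norm x"
proof -
  have "cinner (a *\<^sub>C x) (a *\<^sub>C x) = (a * cnj a) * cinner x x"
    by (simp add: cinner_scaleC_left cinner_scaleC_right)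
  also have "\<dots> = of_real ((cmod a * norm x)\<^sup>2)"
    by (simp add: cinner_self complex_norm_square[symmetric] power_mult_distrib)
  finally have "(norm (a *\<^sub>C x))\<^sup>2 = (cmod a * norm x)\<^sup>2"
    by (simp add: norm_sq_eq_cinner)
  then show ?thesis by (simp add: power2_eq_iff_nonneg)
qed

lemma cinner_Cauchy_Schwarz: "cmod (cinner (x::'a::complex_inner) y) \<le> norm x * norm y"
proof (cases "x = 0")
  case False
  \<comment> \<open>The vector \<open>s *\<^sub>R y - c *\<^sub>C x\<close> is \<open>s\<close>
    times the component of \<open>y\<close> orthogonal to \<open>x\<close>; its squared norm carries
    a factor \<open>s\<close>, which cancels.\<close>
  define c where "c = cinner x y"
  define s where "s = (norm x)\<^sup>2"
  have s: "s > 0" using False by (simp add: s_def)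
  have "cinner (s *\<^sub>R y) (c *\<^sub>C x) = of_real s * (c * cnj c)"
    using cinner_commute[of y x]
    by (simp add: scaleR_eq_scaleC cinner_scaleC_left cinner_scaleC_right c_def)
  also have "\<dots> = of_real (s * (cmod c)\<^sup>2)"
    by (simp add: complex_norm_square[symmetric])
  finally have i: "Re (cinner (s *\<^sub>R y) (c *\<^sub>C x)) = s * (cmod c)\<^sup>2" by simp
  have "0 \<le> (norm (s *\<^sub>R y - c *\<^sub>C x))\<^sup>2" by simp
  also have "\<dots> = s\<^sup>2 * (norm y)\<^sup>2 - 2 * (s * (cmod c)\<^sup>2) + (cmod c)\<^sup>2 * s"
    unfolding norm_diff_sq i by (simp add: norm_scaleC power_mult_distrib s_def)
  also have "\<dots> = s * (s * (norm y)\<^sup>2 - (cmod c)\<^sup>2)"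
    by (simp add: algebra_simps power2_eq_square)
  finally have "(cmod c)\<^sup>2 \<le> (norm x * norm y)\<^sup>2"
    using s by (simp add: zero_le_mult_iff s_def power_mult_distrib)
  then show ?thesis unfolding c_def by (simp add: power2_le_iff_abs_le)
qed simp

lemma bounded_linear_cinner_right: "bounded_linear (cinner (y::'a::complex_inner))"
  by (rule bounded_linear_intro[where K = "norm y"])
    (auto simp: cinner_add_right cinner_scaleR_right scaleR_conv_of_real mult.commute[of _ "norm y"]
      cinner_Cauchy_Schwarz)

lemma bounded_linear_scaleC: "bounded_linear (\<lambda>x::'a::complex_inner. a *\<^sub>C x)"
  by (rule bounded_linear_intro[where K = "cmod a"])
    (auto simp: scaleC_add_right scaleC_scaleR norm_scaleC)

lemma clinear_on_add: "clinear_on S A \<Longrightarrow> x \<in> S \<Longrightarrow> y \<in> S \<Longrightarrow> A (x + y) = A x + A y"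
  and clinear_on_scaleC: "clinear_on S A \<Longrightarrow> x \<in> S \<Longrightarrow> A (a *\<^sub>C x) = a *\<^sub>C A x"
  by (auto simp: clinear_on_def)

lemma csubspace_zero: "csubspace S \<Longrightarrow> 0 \<in> S"
  and csubspace_add: "csubspace S \<Longrightarrow> x \<in> S \<Longrightarrow> y \<in> S \<Longrightarrow> x + y \<in> S"
  and csubspace_scaleC: "csubspace S \<Longrightarrow> x \<in> S \<Longrightarrow> a *\<^sub>C x \<in> S"
  by (auto simp: csubspace_def)

lemma csubspace_scaleR: "csubspace S \<Longrightarrow> x \<in> S \<Longrightarrow> r *\<^sub>R x \<in> S"
  by (simp add: scaleR_eq_scaleC csubspace_scaleC)

lemma csubspace_diff: "csubspace S \<Longrightarrow> x \<in> S \<Longrightarrow> y \<in> S \<Longrightarrow> x - y \<in> S"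
  using csubspace_add[of S x "-y"] csubspace_scaleC[of S y "-1"] by simp

lemma csubspace_UNIV: "csubspace UNIV"
  by (simp add: csubspace_def)

lemma clinear_on_diff:
  assumes "clinear_on S A" "csubspace S" "x \<in> S" "y \<in> S"
  shows "A (x - y) = A x - A y"
proof -
  have "A ((x - y) + y) = A (x - y) + A y"
    using assms by (intro clinear_on_add csubspace_diff)
  then show ?thesis by simp
qed

lemma clinear_on_zero: "clinear_on S A \<Longrightarrow> csubspace S \<Longrightarrow> A 0 = 0"
  using clinear_on_scaleC[of S A 0 0] by (simp add: csubspace_zero)

section \<open>Riesz representation, projections and adjoints on closed subspaces\<close>

text \<open>The representing vector minimizes \<open>\<parallel>x\<parallel>\<^sup>2 - 2 Re \<phi>(x)\<close> over \<open>F\<close>; a minimizing sequence is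
  Cauchy by the parallelogram law.\<close>

lemma Riesz_representation_on:
  fixes F :: "'a::chilbert_space set" and \<phi> :: "'a \<Rightarrow> complex"
  assumes F: "closed_csubspace F"
    and add: "\<And>x y. x \<in> F \<Longrightarrow> y \<in> F \<Longrightarrow> \<phi> (x + y) = \<phi> x + \<phi> y"
    and scale: "\<And>a x. x \<in> F \<Longrightarrow> \<phi> (a *\<^sub>C x) = a * \<phi> x"
    and bound: "\<And>x. x \<in> F \<Longrightarrow> cmod (\<phi> x) \<le> K * norm x"
  shows "\<exists>r\<in>F. \<forall>x\<in>F. \<phi> x = cinner r x"
proof -
  have sub: "csubspace F" and cl: "closed F" using F by (auto simp: closed_csubspace_def)
  define J where "J x = (norm x)\<^sup>2 - 2 * Re (\<phi> x)" for x
  have scaleR: "\<phi> (r *\<^sub>R x) = of_real r * \<phi> x" if "x \<in> F" for r x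
    using scale[OF that, of "of_real r"] by (simp add: scaleC_of_real)
  have lower: "- K\<^sup>2 \<le> J x" if "x \<in> F" for x
  proof -
    have "Re (\<phi> x) \<le> K * norm x"
      using bound[OF that] complex_Re_le_cmod[of "\<phi> x"] by linarith
    moreover have "0 \<le> (norm x - K)\<^sup>2" by simp
    ultimately show ?thesis unfolding J_def by (simp add: power2_eq_square algebra_simps)
  qed
  define m where "m = Inf (J ` F)"
  have bdd: "bdd_below (J ` F)" using lower by (auto intro!: bdd_belowI)
  have m_le: "m \<le> J x" if "x \<in> F" for x
    unfolding m_def using that bdd by (intro cInf_lower) auto
  have "\<exists>x\<in>F. J x < m + 1 / real (Suc n)" for n
  proof -
    have "\<exists>y\<in>J ` F. y < m + 1 / real (Suc n)"
      unfolding m_def by (rule cInf_lessD) (use csubspace_zero[OF sub] in auto)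
    then show ?thesis by auto
  qed
  then obtain x where xF: "\<And>n. x n \<in> F" and xJ: "\<And>n. J (x n) < m + 1 / real (Suc n)"
    by metis
  have par: "(norm (y - z))\<^sup>2 \<le> 2 * (J y - m) + 2 * (J z - m)" if y: "y \<in> F" and z: "z \<in> F" for y z
  proof -
    have w: "y + z \<in> F" using sub y z by (simp add: csubspace_add)
    have "m \<le> J ((1/2) *\<^sub>R (y + z))" using w sub by (intro m_le csubspace_scaleR)
    also have "\<dots> = (norm (y + z))\<^sup>2 / 4 - Re (\<phi> y) - Re (\<phi> z)"
      unfolding J_def by (simp only: scaleR[OF w] add[OF y z] norm_scaleR) (simp add: power_divide field_simps)
    finally show ?thesis
      unfolding J_def norm_add_sq norm_diff_sq by argo
  qed
  have "Cauchy x"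
  proof (rule CauchyI)
    fix e :: real assume e: "0 < e"
    obtain M where M: "4 / e\<^sup>2 < real M" using reals_Archimedean2 by blast
    show "\<exists>M. \<forall>m\<ge>M. \<forall>n\<ge>M. norm (x m - x n) < e"
    proof (intro exI allI impI)
      fix i j assume i: "M \<le> i" and j: "M \<le> j"
      have Mpos: "0 < real M" using M e by (smt (verit) divide_nonneg_nonneg zero_le_power2)
      have le: "1 / real (Suc k) \<le> 1 / real M" if "M \<le> k" for k
        using that Mpos by (intro divide_left_mono) auto
      have "J (x i) < m + 1 / real M" "J (x j) < m + 1 / real M"
        using less_le_trans[OF xJ] le[OF i] le[OF j] by auto
      then have "(norm (x i - x j))\<^sup>2 < 4 * (1 / real M)"
        using par[OF xF xF, of i j] by argo
      also have "\<dots> < e\<^sup>2" using M e Mpos by (simp add: field_simps)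
      finally show "norm (x i - x j) < e"
        using e by (simp add: power2_less_imp_less)
    qed
  qed
  then obtain r where lim: "x \<longlonglongrightarrow> r" by (auto simp: Cauchy_convergent_iff convergent_def)
  have rF: "r \<in> F" using closed_sequentially[OF cl] xF lim by blast
  have minus: "\<phi> (y - z) = \<phi> y - \<phi> z" if "y \<in> F" "z \<in> F" for y z
    using add[of "y - z" z] that csubspace_diff[OF sub] by simp
  have *: "(\<lambda>n. K * norm (x n - r)) \<longlonglongrightarrow> K * 0"
    using lim by (intro tendsto_mult tendsto_const) (simp add: LIM_zero tendsto_norm_zero)
  have "norm (\<phi> (x n) - \<phi> r) \<le> K * norm (x n - r)" for n
    using bound[OF csubspace_diff[OF sub xF rF], of n] minus[OF xF rF, of n] by simp
  then have "(\<lambda>n. \<phi> (x n) - \<phi> r) \<longlonglongrightarrow> 0"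
    by (intro Lim_null_comparison[OF _ *[simplified]] always_eventually) simp
  then have "(\<lambda>n. \<phi> (x n)) \<longlonglongrightarrow> \<phi> r" by (simp only: LIM_zero_iff)
  then have "(\<lambda>n. J (x n)) \<longlonglongrightarrow> J r"
    unfolding J_def
    by (intro tendsto_diff tendsto_mult tendsto_power tendsto_norm tendsto_const tendsto_Re lim)
  moreover have "(\<lambda>n. m + 1 / real (Suc n)) \<longlonglongrightarrow> m + 0"
    by (intro tendsto_intros LIMSEQ_Suc[OF lim_1_over_n])
  ultimately have "J r \<le> m + 0"
    using xJ by (intro LIMSEQ_le) (auto intro: less_imp_le)
  then have min: "J r \<le> J y" if "y \<in> F" for y using m_le[OF that] by simp
  have re: "Re (\<phi> z) = Re (cinner r z)" if z: "z \<in> F" for z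
  proof -
    define d where "d = Re (cinner r z) - Re (\<phi> z)"
    have quad: "0 \<le> t\<^sup>2 * (norm z)\<^sup>2 + 2 * t * d" for t :: real
    proof -
      have "J r \<le> J (r + t *\<^sub>R z)"
        using rF z sub by (intro min csubspace_add csubspace_scaleR)
      then show ?thesis
        using rF z sub unfolding J_def d_def
        by (simp add: norm_add_sq add scaleR csubspace_scaleR cinner_scaleR_right
            power_mult_distrib algebra_simps)
    qed
    \<comment> \<open>At \<open>t = - d / s\<close> the quadratic equals
      \<open>- (d / s)\<^sup>2 * ((norm z)\<^sup>2 + 2)\<close>, so its nonnegativity forces
      \<open>d = 0\<close>. The summand 1 keeps \<open>s\<close> positive when
      \<open>z = 0\<close>.\<close>
    define s where "s = (norm z)\<^sup>2 + 1"
    have s: "s > 0" by (simp add: s_def add_nonneg_pos)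
    define e where "e = d / s"
    have d: "d = e * s" using s by (simp add: e_def)
    have "0 \<le> e\<^sup>2 * (norm z)\<^sup>2 + 2 * (- e) * d" using quad[of "- e"] by simp
    then have "e\<^sup>2 * ((norm z)\<^sup>2 + 2) \<le> 0"
      unfolding d s_def by (simp add: algebra_simps power2_eq_square)
    moreover have "0 < e\<^sup>2 * ((norm z)\<^sup>2 + 2)" if "e \<noteq> 0"
      using that by (intro mult_pos_pos) (auto intro: add_nonneg_pos)
    ultimately have "e = 0" by linarith
    then have "d = 0" by (simp add: d)
    then show ?thesis by (simp add: d_def)
  qed
  have "\<phi> z = cinner r z" if z: "z \<in> F" for z
  proof (rule complex_eqI)
    show "Re (\<phi> z) = Re (cinner r z)" using re z by blast
    \<comment> \<open>The real-part identity at \<open>\<i> *\<^sub>C z\<close> is the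
      imaginary-part identity at \<open>z\<close>, up to sign.\<close>
    have "Re (\<phi> (\<i> *\<^sub>C z)) = Re (cinner r (\<i> *\<^sub>C z))" using re z sub by (simp add: csubspace_scaleC)
    then show "Im (\<phi> z) = Im (cinner r z)" using z by (simp add: scale cinner_scaleC_right)
  qed
  with rF show ?thesis by blast
qed

text \<open>Two candidates differ by a vector of \<open>F\<close> that is orthogonal to itself. This
  resolves the description operator in \<open>orth_proj\<close>, and the algebraic laws of the
  projection follow by checking candidates.\<close>

lemma orth_proj_unique:
  assumes "csubspace F" "y \<in> F" "\<forall>z\<in>F. cinner z (x - y) = 0"
  shows "orth_proj F x = y"
  unfolding orth_proj_def
proof (rule the_equality)
  fix y' assume y': "y' \<in> F \<and> (\<forall>z\<in>F. cinner z (x - y') = 0)"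
  then have d: "y' - y \<in> F" using assms csubspace_diff by blast
  have "cinner (y' - y) (x - y) - cinner (y' - y) (x - y') = 0"
    using assms(3) y' d by simp
  then have "cinner (y' - y) (y' - y) = 0" by (simp add: cinner_diff_right)
  then show "y' = y" by (simp add: cinner_eq_zero_iff)
qed (use assms in auto)

locale closed_complex_subspace =
  fixes F :: "'u::chilbert_space set"
  assumes F: "closed_csubspace F"
begin

abbreviation P where "P \<equiv> orth_proj F"

lemma sub: "csubspace F"
  using F by (simp add: closed_csubspace_def)

text \<open>The projection of \<open>x\<close> is the Riesz vector of the functional
  \<open>cinner x\<close> restricted to \<open>F\<close>.\<close>

lemma proj_spec: "P x \<in> F \<and> (\<forall>z\<in>F. cinner z (x - P x) = 0)"
proof -
  have "\<exists>r\<in>F. \<forall>z\<in>F. cinner x z = cinner r z"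
    by (rule Riesz_representation_on[where K = "norm x"])
      (auto simp: F cinner_add_right cinner_scaleC_right cinner_Cauchy_Schwarz)
  then obtain r where r: "r \<in> F" "\<And>z. z \<in> F \<Longrightarrow> cinner x z = cinner r z" by blast
  have "cinner z (x - r) = 0" if "z \<in> F" for z
    using r(2)[OF that] cinner_commute[of z x] cinner_commute[of z r]
    by (simp add: cinner_diff_right)
  with r orth_proj_unique[OF sub, of r x] show ?thesis by auto
qed

lemma proj_in [simp]: "P x \<in> F"
  and cinner_proj: "z \<in> F \<Longrightarrow> cinner z (P x) = cinner z x"
  using proj_spec[of x] by (auto simp: cinner_diff_right)

lemma proj_id: "x \<in> F \<Longrightarrow> P x = x"
  by (rule orth_proj_unique[OF sub]) auto

lemma proj_add: "P (x + y) = P x + P y"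
  by (rule orth_proj_unique[OF sub])
    (auto simp: csubspace_add sub cinner_diff_right cinner_add_right cinner_proj)

lemma proj_scaleC: "P (a *\<^sub>C x) = a *\<^sub>C P x"
  by (rule orth_proj_unique[OF sub])
    (auto simp: csubspace_scaleC sub cinner_diff_right cinner_scaleC_right cinner_proj)

lemma proj_orth: "(\<And>z. z \<in> F \<Longrightarrow> cinner z x = 0) \<Longrightarrow> P x = 0"
  by (rule orth_proj_unique[OF sub]) (auto simp: csubspace_zero sub)

lemma cinner_proj_compl: "z \<in> F \<Longrightarrow> cinner z (x - P x) = 0"
  using proj_spec[of x] by blast

lemma norm_sq_proj: "(norm x)\<^sup>2 = (norm (P x))\<^sup>2 + (norm (x - P x))\<^sup>2"
  using norm_add_sq[of "P x" "x - P x"] cinner_proj_compl[of "P x" x] by simp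

text \<open>For each \<open>y\<close>, the value \<open>B y\<close> is the Riesz vector in
  \<open>F\<close> of the functional sending \<open>x\<close> to
  \<open>cinner y (A x)\<close>.\<close>

lemma adjoint_on:
  fixes A :: "'u \<Rightarrow> 'y::complex_inner"
  assumes lin: "clinear_on F A" and contr: "\<And>x. x \<in> F \<Longrightarrow> norm (A x) \<le> norm x"
  shows "\<exists>B. (\<forall>y. B y \<in> F) \<and> (\<forall>x\<in>F. \<forall>y. cinner (A x) y = cinner x (B y))"
proof -
  have "\<exists>r\<in>F. \<forall>x\<in>F. cinner y (A x) = cinner r x" for y
  proof (rule Riesz_representation_on[where K = "norm y"])
    fix x assume "x \<in> F"
    then have "norm y * norm (A x) \<le> norm y * norm x" by (simp add: contr mult_left_mono)
    then show "cmod (cinner y (A x)) \<le> norm y * norm x"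
      using cinner_Cauchy_Schwarz[of y "A x"] by linarith
  qed (use lin F in \<open>auto simp: clinear_on_def cinner_add_right cinner_scaleC_right\<close>)
  then obtain B where B: "\<And>y. B y \<in> F" "\<And>y x. x \<in> F \<Longrightarrow> cinner y (A x) = cinner (B y) x"
    by metis
  have "cinner (A x) y = cinner x (B y)" if "x \<in> F" for x y
    using B(2)[OF that, of y] cinner_commute[of "A x" y] cinner_commute[of x "B y"] by simp
  with B(1) show ?thesis by blast
qed

text \<open>Let \<open>g\<close> be orthogonal to \<open>F\<close> and \<open>y = D g\<close>. The
  vector \<open>B y\<close> is mapped to \<open>y\<close> and has the same norm. Moving from
  \<open>B y\<close> to \<open>B y + t *\<^sub>R g\<close> enlarges the squared norm of the image to
  first order in \<open>t\<close>, but that of the argument only to second order, so a contraction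
  must have \<open>y = 0\<close>.\<close>

lemma contraction_vanishes_off_coisometry:
  fixes D A :: "'u \<Rightarrow> 'y::complex_inner"
  assumes lin: "clinear_on UNIV D" and contr: "\<And>u. norm (D u) \<le> norm u"
    and ext: "\<And>x. x \<in> F \<Longrightarrow> D x = A x" and co: "coisometry_on F A"
  shows "D u = A (P u)"
proof -
  obtain B where B: "\<And>y. B y \<in> F" "\<And>x y. x \<in> F \<Longrightarrow> cinner (A x) y = cinner x (B y)"
    "\<And>y. A (B y) = y"
    using co by (auto simp: coisometry_on_def)
  define g where "g = u - P u"
  define y where "y = D g"
  have nB: "(norm (B y))\<^sup>2 = (norm y)\<^sup>2"
    using B(2)[OF B(1), of y y] by (simp add: B(3) norm_sq_eq_cinner)
  have key: "2 * (norm y)\<^sup>2 \<le> t * (norm g)\<^sup>2" if t: "t > 0" for t :: real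
  proof -
    have "D (B y + t *\<^sub>R g) = y + t *\<^sub>R y"
      using lin by (simp add: clinear_on_add scaleR_eq_scaleC clinear_on_scaleC ext B y_def)
    also have "\<dots> = (1 + t) *\<^sub>R y" by (simp add: scaleR_add_left)
    finally have "((1 + t) * norm y)\<^sup>2 \<le> (norm (B y + t *\<^sub>R g))\<^sup>2"
      using contr[of "B y + t *\<^sub>R g"] t by simp
    also have "\<dots> = (norm y)\<^sup>2 + t\<^sup>2 * (norm g)\<^sup>2"
      using cinner_proj_compl[OF B(1)[of y], of u] nB
      by (simp add: norm_add_sq cinner_scaleR_right g_def power_mult_distrib)
    finally have "t * (2 * (norm y)\<^sup>2 + t * (norm y)\<^sup>2) \<le> t * (t * (norm g)\<^sup>2)"
      by (simp add: power2_eq_square algebra_simps)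
    then have "2 * (norm y)\<^sup>2 + t * (norm y)\<^sup>2 \<le> t * (norm g)\<^sup>2"
      using t by (simp only: mult_le_cancel_left_pos)
    moreover have "0 \<le> t * (norm y)\<^sup>2" using t by simp
    ultimately show ?thesis by linarith
  qed
  have "y = 0"
  proof (rule ccontr)
    assume "y \<noteq> 0"
    then have yp: "(norm y)\<^sup>2 > 0" by simp
    have gp: "(norm g)\<^sup>2 + 1 > 0" by (simp add: add_nonneg_pos)
    \<comment> \<open>This makes \<open>t * (norm g)\<^sup>2\<close> at most
      \<open>(norm y)\<^sup>2\<close>, against the lower bound \<open>2 * (norm y)\<^sup>2\<close>
      in \<open>key\<close>.\<close>
    define t where "t = (norm y)\<^sup>2 / ((norm g)\<^sup>2 + 1)"
    have "t > 0" using yp gp by (simp add: t_def)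
    moreover have "t * ((norm g)\<^sup>2 + 1) = (norm y)\<^sup>2" using gp by (simp add: t_def)
    ultimately show False using key[of t] yp by (simp add: algebra_simps)
  qed
  then have "D (u - P u) = 0" by (simp add: y_def g_def)
  then have "D u = D (P u)" using clinear_on_diff[OF lin csubspace_UNIV] by auto
  then show ?thesis by (simp add: ext)
qed

end

section \<open>Hardy space coefficients\<close>

text \<open>Once all lower coefficients vanish, division by \<open>z ^ k\<close> leaves a series
  with constant term \<open>a k\<close> that is zero on the punctured disc; let \<open>z\<close>
  tend to 0.\<close>

lemma complex_powser_sums_zero_imp:
  fixes a :: "nat \<Rightarrow> complex"
  assumes sums: "\<And>z. cmod z < 1 \<Longrightarrow> (\<lambda>n. a n * z ^ n) sums 0"
  shows "a k = 0"
proof (induction k rule: less_induct)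
  case (less k)
  have "(\<lambda>n. a (n + k) * z ^ n) sums 0" if z: "z \<noteq> 0" "norm z < 1" for z
  proof -
    have "(\<lambda>n. a (n + k) * z ^ (n + k)) sums 0"
      using sums[OF z(2)] less sums_iff_shift[of "\<lambda>n. a n * z ^ n" k 0] by simp
    then have "(\<lambda>n. a (n + k) * z ^ (n + k) / z ^ k) sums (0 / z ^ k)" by (rule sums_divide)
    then show ?thesis using z by (simp add: power_add)
  qed
  then have "((\<lambda>_. 0) \<longlongrightarrow> a (0 + k)) (at (0::complex))"
    using powser_limit_0_strong[of 1 "\<lambda>n. a (n + k)" "\<lambda>_. 0"] by auto
  then show ?case using LIM_const_eq by fastforce
qed

text \<open>Pairing the difference of the two series with the vector \<open>a k - b k\<close>
  reduces the claim to scalar series.\<close>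

lemma power_series_coeffs_unique:
  fixes a b :: "nat \<Rightarrow> 'y::complex_inner"
  assumes a: "\<And>z. cmod z < 1 \<Longrightarrow> (\<lambda>n. z ^ n *\<^sub>C a n) sums f z"
    and b: "\<And>z. cmod z < 1 \<Longrightarrow> (\<lambda>n. z ^ n *\<^sub>C b n) sums f z"
  shows "a = b"
proof
  fix k
  define y where "y = a k - b k"
  have "(\<lambda>n. cinner y (a n - b n) * z ^ n) sums 0" if z: "cmod z < 1" for z
  proof -
    have "(\<lambda>n. z ^ n *\<^sub>C (a n - b n)) sums 0"
      using sums_diff[OF a[OF z] b[OF z]] by (simp add: scaleC_diff_right)
    from bounded_linear.sums[OF bounded_linear_cinner_right this, of y]
    show ?thesis by (simp add: cinner_scaleC_right mult.commute)
  qed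
  then have "cinner y (a k - b k) = 0"
    by (rule complex_powser_sums_zero_imp[where a = "\<lambda>n. cinner y (a n - b n)"])
  then show "a k = b k" by (simp add: y_def cinner_eq_zero_iff)
qed

lemma H2_coeffs_unique:
  assumes "H2_coeffs f a" "H2_coeffs f b"
  shows "a = b"
  by (rule power_series_coeffs_unique[where f = f]) (use assms in \<open>auto simp: H2_coeffs_def\<close>)

text \<open>Uniqueness of the coefficients removes the choice made in
  \<open>hardy2_norm\<close>.\<close>

lemma hardy2_norm_eq:
  assumes "H2_coeffs f a"
  shows "hardy2_norm f = sqrt (\<Sum>n. (norm (a n))\<^sup>2)"
proof -
  have "(SOME a. H2_coeffs f a) = a"
    using assms H2_coeffs_unique by (intro some_equality)
  then show ?thesis by (simp add: hardy2_norm_def)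
qed

text \<open>Linearity of \<open>H z\<close> passes to the coefficients by their uniqueness, and each
  coefficient is a contraction because one term of the square sum is at most the whole.\<close>

lemma H2_ball_coeffs:
  fixes H :: "complex \<Rightarrow> 'u::complex_inner \<Rightarrow> 'y::complex_inner"
  assumes H: "H \<in> H2_ball"
  obtains h where "\<And>u. H2_coeffs (\<lambda>z. H z u) (\<lambda>n. h n u)"
    "\<And>n. clinear_on UNIV (h n)" "\<And>n u. norm (h n u) \<le> norm u"
proof -
  have "\<exists>a. H2_coeffs (\<lambda>z. H z u) a" for u using H by (auto simp: H2_ball_def hardy2_def)
  then obtain c where c: "\<And>u. H2_coeffs (\<lambda>z. H z u) (c u)" by metis
  have cs: "(\<lambda>n. z ^ n *\<^sub>C c u n) sums H z u" if "cmod z < 1" for z u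
    using c that by (auto simp: H2_coeffs_def)
  have lin: "clinear_on UNIV (H z)" if "cmod z < 1" for z
    using H that by (auto simp: H2_ball_def bounded_clinear_def)
  have "c (u + v) = (\<lambda>n. c u n + c v n)" for u v
  proof (rule power_series_coeffs_unique[where f = "\<lambda>z. H z (u + v)"])
    fix z :: complex assume z: "cmod z < 1"
    show "(\<lambda>n. z ^ n *\<^sub>C (c u n + c v n)) sums H z (u + v)"
      using sums_add[OF cs[OF z] cs[OF z], of u v]
      by (simp add: clinear_on_add[OF lin[OF z]] scaleC_add_right)
  qed (rule cs)
  moreover have "c (k *\<^sub>C u) = (\<lambda>n. k *\<^sub>C c u n)" for k u
  proof (rule power_series_coeffs_unique[where f = "\<lambda>z. H z (k *\<^sub>C u)"])
    fix z :: complex assume z: "cmod z < 1"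
    show "(\<lambda>n. z ^ n *\<^sub>C k *\<^sub>C c u n) sums H z (k *\<^sub>C u)"
      using bounded_linear.sums[OF bounded_linear_scaleC cs[OF z], of k u]
      by (simp add: clinear_on_scaleC[OF lin[OF z]] scaleC_scaleC mult.commute)
  qed (rule cs)
  ultimately have l: "clinear_on UNIV (\<lambda>u. c u n)" for n by (simp add: clinear_on_def)
  have b: "norm (c u n) \<le> norm u" for u n
  proof -
    have s: "summable (\<lambda>n. (norm (c u n))\<^sup>2)" using c by (auto simp: H2_coeffs_def)
    have "hardy2_norm (\<lambda>z. H z u) \<le> norm u" using H by (simp add: H2_ball_def)
    then have "sqrt (\<Sum>n. (norm (c u n))\<^sup>2) \<le> norm u" by (simp only: hardy2_norm_eq[OF c])
    then have "(\<Sum>n. (norm (c u n))\<^sup>2) \<le> (norm u)\<^sup>2" by (rule sqrt_le_D)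
    moreover have "(norm (c u n))\<^sup>2 \<le> (\<Sum>n. (norm (c u n))\<^sup>2)"
      using sum_le_suminf[OF s, of "{n}"] by simp
    ultimately show ?thesis by (meson norm_ge_zero order_trans power2_le_imp_le)
  qed
  show thesis by (rule that[of "\<lambda>n u. c u n"]) (use c l b in auto)
qed

text \<open>The bound on partial square sums yields the Hardy norm estimate. It also makes each
  coefficient a contraction, so a geometric series majorizes the power series and bounds
  \<open>H z\<close> by \<open>1 / (1 - cmod z)\<close>.\<close>

lemma power_series_in_H2_ball:
  fixes h :: "nat \<Rightarrow> 'u::complex_inner \<Rightarrow> 'y::chilbert_space"
  defines "H \<equiv> \<lambda>z u. \<Sum>n. z ^ n *\<^sub>C h n u"
  assumes lin: "\<And>n. clinear_on UNIV (h n)"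
    and bound: "\<And>N u. (\<Sum>n<N. (norm (h n u))\<^sup>2) \<le> (norm u)\<^sup>2"
  shows "H \<in> H2_ball" and "H2_coeffs (\<lambda>z. H z u) (\<lambda>n. h n u)"
proof -
  have b: "norm (h n u) \<le> norm u" for n u
  proof -
    have "(norm (h n u))\<^sup>2 \<le> (\<Sum>i<Suc n. (norm (h i u))\<^sup>2)" by (simp add: sum_nonneg)
    also have "\<dots> \<le> (norm u)\<^sup>2" by (rule bound)
    finally show ?thesis by (rule power2_le_imp_le) simp
  qed
  have tm: "norm (z ^ n *\<^sub>C h n u) \<le> cmod z ^ n * norm u" for z n u
    by (simp add: norm_scaleC norm_power b mult_left_mono)
  have geo: "(\<lambda>n. cmod z ^ n * norm u) sums (1 / (1 - cmod z) * norm u)" if "cmod z < 1" for z and u :: 'u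
    using that by (intro sums_mult2 geometric_sums) auto
  have sm: "summable (\<lambda>n. z ^ n *\<^sub>C h n u)" if "cmod z < 1" for z u
    using summable_comparison_test'[OF sums_summable[OF geo[OF that]] tm] .
  have sums: "(\<lambda>n. z ^ n *\<^sub>C h n u) sums H z u" if "cmod z < 1" for z u
    unfolding H_def using sm[OF that] by (rule summable_sums)
  have sq: "summable (\<lambda>n. (norm (h n u))\<^sup>2)" for u
    by (rule bounded_imp_summable[where B = "(norm u)\<^sup>2"])
      (use bound[of u "Suc _"] in \<open>auto simp: lessThan_Suc_atMost\<close>)
  show co: "H2_coeffs (\<lambda>z. H z u) (\<lambda>n. h n u)" for u
    unfolding H2_coeffs_def using sq sums by blast
  have "hardy2_norm (\<lambda>z. H z u) \<le> norm u" for u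
  proof -
    have "(\<Sum>n. (norm (h n u))\<^sup>2) \<le> (norm u)\<^sup>2" using sq bound by (rule suminf_le_const)
    then show ?thesis using hardy2_norm_eq[OF co[of u]] by (simp add: real_le_lsqrt suminf_nonneg sq)
  qed
  moreover have "bounded_clinear (H z)" if z: "cmod z < 1" for z
    unfolding bounded_clinear_def
  proof
    show "clinear_on UNIV (H z)" unfolding clinear_on_def
    proof (intro conjI ballI allI)
      fix u v :: 'u
      have "(\<lambda>n. z ^ n *\<^sub>C h n (u + v)) sums (H z u + H z v)"
        using sums_add[OF sums[OF z] sums[OF z], of u v]
        by (simp add: clinear_on_add[OF lin] scaleC_add_right)
      then show "H z (u + v) = H z u + H z v" by (rule sums_unique2[OF sums[OF z]])
    next
      fix k and u :: 'u
      have "(\<lambda>n. z ^ n *\<^sub>C h n (k *\<^sub>C u)) sums (k *\<^sub>C H z u)"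
        using bounded_linear.sums[OF bounded_linear_scaleC sums[OF z, of u], of k]
        by (simp add: clinear_on_scaleC[OF lin] scaleC_scaleC mult.commute)
      then show "H z (k *\<^sub>C u) = k *\<^sub>C H z u" by (rule sums_unique2[OF sums[OF z]])
    qed
    have "norm (H z u) \<le> 1 / (1 - cmod z) * norm u" for u
      unfolding H_def sums_unique[OF geo[OF z]]
      by (rule norm_suminf_le[OF tm sums_summable[OF geo[OF z]]])
    then show "\<exists>K. \<forall>u. norm (H z u) \<le> K * norm u" by blast
  qed
  ultimately show "H \<in> H2_ball" using co by (auto simp: H2_ball_def hardy2_def)
qed

text \<open>Multiplication by \<open>z\<close> shifts coefficients: the left side of the
  interpolation condition has the coefficient sequence \<open>c x\<close>, which is then compared
  with that of the right side.\<close>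

lemma interpolation_iff_coeffs:
  assumes h: "\<And>u. H2_coeffs (\<lambda>z. H z u) (\<lambda>n. h n u)"
  shows "(\<forall>z. cmod z < 1 \<longrightarrow> (\<forall>x\<in>F. \<omega>1 x + z *\<^sub>C H z (\<omega>2 x) = H z x)) \<longleftrightarrow>
    (\<forall>x\<in>F. h 0 x = \<omega>1 x \<and> (\<forall>n. h (Suc n) x = h n (\<omega>2 x)))"
proof -
  define c where "c x n = (case n of 0 \<Rightarrow> \<omega>1 x | Suc m \<Rightarrow> h m (\<omega>2 x))" for x n
  have hs: "(\<lambda>n. z ^ n *\<^sub>C h n u) sums H z u" if "cmod z < 1" for z u
    using h that by (auto simp: H2_coeffs_def)
  have cs: "(\<lambda>n. z ^ n *\<^sub>C c x n) sums (\<omega>1 x + z *\<^sub>C H z (\<omega>2 x))" if z: "cmod z < 1" for z x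
  proof -
    have "(\<lambda>n. z ^ Suc n *\<^sub>C c x (Suc n)) sums (z *\<^sub>C H z (\<omega>2 x))"
      using bounded_linear.sums[OF bounded_linear_scaleC hs[OF z], of z "\<omega>2 x"]
      by (simp add: scaleC_scaleC c_def)
    from sums_Suc[OF this] show ?thesis by (simp add: c_def scaleC_one add.commute)
  qed
  have all: "(\<forall>n. Q n) \<longleftrightarrow> Q 0 \<and> (\<forall>n. Q (Suc n))" for Q :: "nat \<Rightarrow> bool"
    by (metis not0_implies_Suc)
  have "(\<forall>z. cmod z < 1 \<longrightarrow> \<omega>1 x + z *\<^sub>C H z (\<omega>2 x) = H z x) \<longleftrightarrow> c x = (\<lambda>n. h n x)" for x
  proof
    assume "\<forall>z. cmod z < 1 \<longrightarrow> \<omega>1 x + z *\<^sub>C H z (\<omega>2 x) = H z x"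
    then show "c x = (\<lambda>n. h n x)"
      using cs hs by (intro power_series_coeffs_unique[where f = "\<lambda>z. H z x"]) metis+
  next
    assume "c x = (\<lambda>n. h n x)"
    then show "\<forall>z. cmod z < 1 \<longrightarrow> \<omega>1 x + z *\<^sub>C H z (\<omega>2 x) = H z x"
      using cs[of _ x] hs[of _ x] sums_unique2 by metis
  qed
  moreover have "c x = (\<lambda>n. h n x) \<longleftrightarrow> h 0 x = \<omega>1 x \<and> (\<forall>n. h (Suc n) x = h n (\<omega>2 x))" for x
    unfolding fun_eq_iff by (subst all) (auto simp: c_def)
  ultimately show ?thesis by blast
qed

section \<open>Solutions from contractive extensions\<close>

lemma contractive_extension_solution:
  fixes C1 :: "'u::complex_inner \<Rightarrow> 'y::chilbert_space" and C2 :: "'u \<Rightarrow> 'u"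
  assumes lin1: "clinear_on UNIV C1" and lin2: "clinear_on UNIV C2"
    and contr: "\<And>u. (norm (C1 u))\<^sup>2 + (norm (C2 u))\<^sup>2 \<le> (norm u)\<^sup>2"
    and ext: "\<And>x. x \<in> F \<Longrightarrow> C1 x = \<omega>1 x" "\<And>x. x \<in> F \<Longrightarrow> C2 x = \<omega>2 x"
  defines "H \<equiv> \<lambda>z u. \<Sum>n. z ^ n *\<^sub>C C1 ((C2 ^^ n) u)"
  shows "H2_interp_solution F \<omega>1 \<omega>2 H"
    and "H2_coeffs (\<lambda>z. H z u) (\<lambda>n. C1 ((C2 ^^ n) u))"
proof -
  have "clinear_on UNIV (\<lambda>u. (C2 ^^ n) u)" for n
    by (induction n) (use lin2 in \<open>auto simp: clinear_on_def\<close>)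
  then have lin: "clinear_on UNIV (\<lambda>u. C1 ((C2 ^^ n) u))" for n
    using lin1 by (auto simp: clinear_on_def)
  \<comment> \<open>Applying \<open>contr\<close> along the orbit of \<open>u\<close> gives a
    telescoping sum: what \<open>C1\<close> emits at each step is paid for by the loss of norm under
    \<open>C2\<close>.\<close>
  have tele: "(\<Sum>n<N. (norm (C1 ((C2 ^^ n) u)))\<^sup>2) + (norm ((C2 ^^ N) u))\<^sup>2 \<le> (norm u)\<^sup>2" for N u
  proof (induction N)
    case (Suc N)
    then show ?case using contr[of "(C2 ^^ N) u"] by simp
  qed simp
  have bound: "(\<Sum>n<N. (norm (C1 ((C2 ^^ n) u)))\<^sup>2) \<le> (norm u)\<^sup>2" for N u
    using tele[where N = N and u = u] zero_le_power2[of "norm ((C2 ^^ N) u)"] by linarith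
  note ball = power_series_in_H2_ball[of "\<lambda>n u. C1 ((C2 ^^ n) u)", OF lin bound]
  show co: "H2_coeffs (\<lambda>z. H z u) (\<lambda>n. C1 ((C2 ^^ n) u))" for u
    unfolding H_def by (rule ball(2))
  \<comment> \<open>The power of \<open>C2\<close> is peeled at its inner end, where the argument
    lies in \<open>F\<close> and \<open>C2\<close> agrees with \<open>\<omega>2\<close>.\<close>
  show "H2_interp_solution F \<omega>1 \<omega>2 H"
    unfolding H2_interp_solution_def interpolation_iff_coeffs[of H, OF co]
    using ball(1) by (auto simp: H_def ext funpow_Suc_right simp del: funpow.simps(2))
qed

section \<open>Interpolation data and the central solution\<close>

locale interpolation_data = closed_complex_subspace F
  for F :: "'u::chilbert_space set" +
  fixes \<omega>1 :: "'u \<Rightarrow> 'y::chilbert_space" and \<omega>2 :: "'u \<Rightarrow> 'u"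
  assumes lin1: "clinear_on F \<omega>1" and lin2: "clinear_on F \<omega>2"
    and contr: "\<And>x. x \<in> F \<Longrightarrow> (norm (\<omega>1 x))\<^sup>2 + (norm (\<omega>2 x))\<^sup>2 \<le> (norm x)\<^sup>2"
begin

definition A where "A n = \<omega>1 \<circ> ((\<lambda>x. P (\<omega>2 x)) ^^ n)"

text \<open>Solutions are compared only on the open disc, since the values of the total function
  \<open>H\<close> elsewhere are unconstrained.\<close>

definition unique_solution where
  "unique_solution \<longleftrightarrow> (\<exists>H. H2_interp_solution F \<omega>1 \<omega>2 H \<and>
     (\<forall>H'. H2_interp_solution F \<omega>1 \<omega>2 H' \<longrightarrow> (\<forall>z. cmod z < 1 \<longrightarrow> H' z = H z)))"

lemma A_0: "A 0 x = \<omega>1 x"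
  and A_Suc: "A (Suc n) x = A n (P (\<omega>2 x))"
  by (simp_all add: A_def funpow_Suc_right del: funpow.simps(2))

text \<open>Identifies the coefficients of the central solution, built from iterates on the whole
  space, with \<open>A n\<close> after projection.\<close>

lemma A_compose: "A n (P u) = \<omega>1 (P (((\<lambda>u. \<omega>2 (P u)) ^^ n) u))"
proof -
  have "((\<lambda>x. P (\<omega>2 x)) ^^ n) (P u) = P (((\<lambda>u. \<omega>2 (P u)) ^^ n) u)"
    by (induction n) auto
  then show ?thesis by (simp add: A_def)
qed

lemma A_add: "x \<in> F \<Longrightarrow> y \<in> F \<Longrightarrow> A n (x + y) = A n x + A n y"
  by (induction n arbitrary: x y)
    (auto simp: A_0 A_Suc clinear_on_add[OF lin1] clinear_on_add[OF lin2] proj_add)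

lemma A_scaleC: "x \<in> F \<Longrightarrow> A n (a *\<^sub>C x) = a *\<^sub>C A n x"
  by (induction n arbitrary: x)
    (auto simp: A_0 A_Suc clinear_on_scaleC[OF lin1] clinear_on_scaleC[OF lin2] proj_scaleC)

lemma A_linear: "clinear_on F (A n)"
  by (simp add: clinear_on_def A_add A_scaleC)

text \<open>Extending the data by zero on the orthogonal complement of \<open>F\<close> provides a
  contractive extension, hence existence of a solution.\<close>

lemma central_extension:
  shows "clinear_on UNIV (\<lambda>u. \<omega>1 (P u))" "clinear_on UNIV (\<lambda>u. \<omega>2 (P u))"
    and "(norm (\<omega>1 (P u)))\<^sup>2 + (norm (\<omega>2 (P u)))\<^sup>2 \<le> (norm u)\<^sup>2"
proof -
  show "clinear_on UNIV (\<lambda>u. \<omega>1 (P u))" "clinear_on UNIV (\<lambda>u. \<omega>2 (P u))"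
    using lin1 lin2 by (auto simp: clinear_on_def proj_add proj_scaleC)
  show "(norm (\<omega>1 (P u)))\<^sup>2 + (norm (\<omega>2 (P u)))\<^sup>2 \<le> (norm u)\<^sup>2"
    using contr[OF proj_in[of u]] norm_sq_proj[of u] zero_le_power2[of "norm (u - P u)"] by linarith
qed

lemmas central_solution = contractive_extension_solution
  [where ?C1.0 = "\<lambda>u. \<omega>1 (P u)" and ?C2.0 = "\<lambda>u. \<omega>2 (P u)" and F = F and ?\<omega>1.0 = \<omega>1 and ?\<omega>2.0 = \<omega>2,
    OF central_extension]

text \<open>Turns uniqueness into operator identities: every contractive extension must produce the
  coefficients of the central one.\<close>

lemma unique_extension_coeffs:
  assumes "unique_solution"
    and "clinear_on UNIV C1" "clinear_on UNIV C2"
    and "\<And>u. (norm (C1 u))\<^sup>2 + (norm (C2 u))\<^sup>2 \<le> (norm u)\<^sup>2"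
    and "\<And>x. x \<in> F \<Longrightarrow> C1 x = \<omega>1 x" "\<And>x. x \<in> F \<Longrightarrow> C2 x = \<omega>2 x"
  shows "C1 ((C2 ^^ n) u) = A n (P u)"
proof -
  define H where "H = (\<lambda>z u. \<Sum>n. z ^ n *\<^sub>C C1 ((C2 ^^ n) u))"
  define H0 where "H0 = (\<lambda>z u. \<Sum>n. z ^ n *\<^sub>C \<omega>1 (P (((\<lambda>u. \<omega>2 (P u)) ^^ n) u)))"
  have H: "H2_interp_solution F \<omega>1 \<omega>2 H" "H2_coeffs (\<lambda>z. H z u) (\<lambda>n. C1 ((C2 ^^ n) u))"
    using contractive_extension_solution[OF assms(2-6)] by (auto simp: H_def)
  have H0: "H2_interp_solution F \<omega>1 \<omega>2 H0"
    "H2_coeffs (\<lambda>z. H0 z u) (\<lambda>n. \<omega>1 (P (((\<lambda>u. \<omega>2 (P u)) ^^ n) u)))"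
    using central_solution by (auto simp: H0_def proj_id)
  have eq: "H z = H0 z" if "cmod z < 1" for z
    using assms(1) H(1) H0(1) that unfolding unique_solution_def by metis
  have "(\<lambda>n. C1 ((C2 ^^ n) u)) = (\<lambda>n. \<omega>1 (P (((\<lambda>u. \<omega>2 (P u)) ^^ n) u)))"
    by (rule power_series_coeffs_unique[where f = "\<lambda>z. H0 z u"])
      (use H(2) H0(2) eq in \<open>auto simp: H2_coeffs_def\<close>)
  then show ?thesis by (simp add: A_compose fun_eq_iff)
qed

section \<open>Necessity: adjoints and defect perturbations\<close>

lemma adjoints:
  obtains B1 B2 where "\<And>y. B1 y \<in> F" "\<And>x y. x \<in> F \<Longrightarrow> cinner (\<omega>1 x) y = cinner x (B1 y)"
    "\<And>u. B2 u \<in> F" "\<And>x u. x \<in> F \<Longrightarrow> cinner (\<omega>2 x) u = cinner x (B2 u)"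
proof -
  have 1: "norm (\<omega>1 x) \<le> norm x" if "x \<in> F" for x
    by (rule power2_le_imp_le) (use contr[OF that] zero_le_power2[of "norm (\<omega>2 x)"] in linarith, simp)
  have 2: "norm (\<omega>2 x) \<le> norm x" if "x \<in> F" for x
    by (rule power2_le_imp_le) (use contr[OF that] zero_le_power2[of "norm (\<omega>1 x)"] in linarith, simp)
  obtain B1 B2 where "(\<forall>y. B1 y \<in> F) \<and> (\<forall>x\<in>F. \<forall>y. cinner (\<omega>1 x) y = cinner x (B1 y))"
    "(\<forall>y. B2 y \<in> F) \<and> (\<forall>x\<in>F. \<forall>y. cinner (\<omega>2 x) y = cinner x (B2 y))"
    using adjoint_on[OF lin1 1] adjoint_on[OF lin2 2] by blast
  then show thesis using that by blast
qed

text \<open>The vector \<open>(k1 - \<omega>1 a, k2 - \<omega>2 a)\<close> with \<open>a = \<omega>\<^sup>*(k1, k2)\<close> is \<open>(I - \<omega>\<omega>\<^sup>*)(k1, k2)\<close>. It may be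
  added to \<open>\<omega>\<close> in a direction orthogonal to \<open>F\<close>: substituting \<open>h = f - c a\<close> in the norm of
  \<open>\<omega> f + c (k - \<omega> a) = \<omega> h + c k\<close> turns the cross term \<open>\<langle>c k, \<omega> h\<rangle>\<close> into \<open>\<langle>c a, h\<rangle>\<close>.\<close>

lemma defect_perturbation_contractive:
  assumes f: "f \<in> F" and a: "a \<in> F"
    and adj: "\<And>x. x \<in> F \<Longrightarrow> cinner (\<omega>1 x) k1 + cinner (\<omega>2 x) k2 = cinner x a"
  shows "(norm (\<omega>1 f + c *\<^sub>C (k1 - \<omega>1 a)))\<^sup>2 + (norm (\<omega>2 f + c *\<^sub>C (k2 - \<omega>2 a)))\<^sup>2
    \<le> (norm f)\<^sup>2 + (cmod c)\<^sup>2 * ((norm k1)\<^sup>2 + (norm k2)\<^sup>2)"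
proof -
  define h where "h = f - c *\<^sub>C a"
  have ca: "c *\<^sub>C a \<in> F" and h: "h \<in> F"
    using a f sub by (auto simp: h_def csubspace_scaleC csubspace_diff)
  have 1: "\<omega>1 f + c *\<^sub>C (k1 - \<omega>1 a) = \<omega>1 h + c *\<^sub>C k1"
    using clinear_on_diff[OF lin1 sub f ca]
    by (simp add: h_def clinear_on_scaleC[OF lin1 a] scaleC_diff_right)
  have 2: "\<omega>2 f + c *\<^sub>C (k2 - \<omega>2 a) = \<omega>2 h + c *\<^sub>C k2"
    using clinear_on_diff[OF lin2 sub f ca]
    by (simp add: h_def clinear_on_scaleC[OF lin2 a] scaleC_diff_right)
  have cross: "Re (cinner (\<omega>1 h) (c *\<^sub>C k1)) + Re (cinner (\<omega>2 h) (c *\<^sub>C k2)) = Re (cinner h (c *\<^sub>C a))"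
    using adj[OF h] by (metis cinner_scaleC_right distrib_left plus_complex.sel(1))
  have "(norm f)\<^sup>2 = (norm h)\<^sup>2 + 2 * Re (cinner h (c *\<^sub>C a)) + (norm (c *\<^sub>C a))\<^sup>2"
    using norm_add_sq[of h "c *\<^sub>C a"] by (simp add: h_def)
  then show ?thesis
    unfolding 1 2 norm_add_sq[of "_ h"] norm_scaleC[of c k1] norm_scaleC[of c k2]
      power_mult_distrib distrib_left
    using contr[OF h] cross zero_le_power2[of "norm (c *\<^sub>C a)"] by linarith
qed

text \<open>The defect vector, multiplied by \<open>cinner g u\<close> for some nonzero
  \<open>g\<close> orthogonal to \<open>F\<close>, is a rank-one perturbation of the central
  extension that is zero on \<open>F\<close>. Uniqueness forces all coefficients of the perturbed
  solution to vanish at \<open>g\<close>, where those of the central one do.\<close>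

lemma unique_solution_kills_defect:
  assumes uniq: "unique_solution" and F: "F \<noteq> UNIV" and a: "a \<in> F"
    and adj: "\<And>x. x \<in> F \<Longrightarrow> cinner (\<omega>1 x) k1 + cinner (\<omega>2 x) k2 = cinner x a"
  shows "\<omega>1 a = k1" and "A n (P (k2 - \<omega>2 a)) = 0"
proof -
  obtain u0 where u0: "u0 \<notin> F" using F by blast
  define g0 where "g0 = u0 - P u0"
  have "g0 \<noteq> 0" using u0 proj_in[of u0] by (metis eq_iff_diff_eq_0 g0_def)
  define K where "K = (norm k1)\<^sup>2 + (norm k2)\<^sup>2"
  \<comment> \<open>Scaling \<open>g0\<close> to norm \<open>1 / (K + 1)\<close> ensures
    \<open>(norm g)\<^sup>2 * K \<le> 1\<close>, also when \<open>K = 0\<close>.\<close>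
  define s where "s = 1 / (norm g0 * (K + 1))"
  have K: "0 \<le> K" by (simp add: K_def)
  define g where "g = s *\<^sub>R g0"
  have ng: "norm g = 1 / (K + 1)" using \<open>g0 \<noteq> 0\<close> K by (simp add: g_def s_def)
  have small: "(norm g)\<^sup>2 * K \<le> 1"
  proof -
    have "K \<le> (K + 1)\<^sup>2" using K by (simp add: power2_eq_square algebra_simps)
    then show ?thesis using K by (simp add: ng power_divide field_simps)
  qed
  have "g \<noteq> 0" using ng K by auto
  have orth: "cinner z g = 0" if "z \<in> F" for z
    using cinner_proj_compl[OF that] by (simp add: g_def g0_def cinner_scaleR_right)
  have orth': "cinner g z = 0" if "z \<in> F" for z
    using orth[OF that] cinner_commute[of g z] by simp
  have Pg: "P g = 0" using orth by (rule proj_orth)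
  define v1 where "v1 = k1 - \<omega>1 a"
  define v2 where "v2 = k2 - \<omega>2 a"
  define C1 where "C1 u = \<omega>1 (P u) + cinner g u *\<^sub>C v1" for u
  define C2 where "C2 u = \<omega>2 (P u) + cinner g u *\<^sub>C v2" for u
  have lC: "clinear_on UNIV C1" "clinear_on UNIV C2"
    using central_extension(1,2)
    by (auto simp: clinear_on_def C1_def C2_def cinner_add_right cinner_scaleC_right
        scaleC_add_left scaleC_add_right scaleC_scaleC)
  have cC: "(norm (C1 u))\<^sup>2 + (norm (C2 u))\<^sup>2 \<le> (norm u)\<^sup>2" for u
  proof -
    \<comment> \<open>The perturbation sees only the part of \<open>u\<close> orthogonal to
      \<open>F\<close>, and the squared norm of that part, left over by the central extension, pays
      for it.\<close>
    have "cinner g u = cinner g (u - P u)" by (simp add: cinner_diff_right orth')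
    then have "cmod (cinner g u) \<le> norm g * norm (u - P u)" by (simp add: cinner_Cauchy_Schwarz)
    then have "(cmod (cinner g u))\<^sup>2 * K \<le> (norm g * norm (u - P u))\<^sup>2 * K"
      using K by (intro mult_right_mono power_mono) auto
    also have "\<dots> = ((norm g)\<^sup>2 * K) * (norm (u - P u))\<^sup>2" by (simp add: power_mult_distrib)
    also have "\<dots> \<le> (norm (u - P u))\<^sup>2" using small K by (intro mult_left_le_one_le) auto
    finally show ?thesis
      using defect_perturbation_contractive[OF proj_in a adj, of u "cinner g u"] norm_sq_proj[of u]
      unfolding C1_def C2_def v1_def v2_def K_def by linarith
  qed
  have eC: "C1 x = \<omega>1 x" "C2 x = \<omega>2 x" if "x \<in> F" for x
    using that by (auto simp: C1_def C2_def proj_id orth')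
  note eq = unique_extension_coeffs[OF uniq lC cC eC]
  have zero: "\<omega>1 0 = 0" "\<omega>2 0 = 0" "A n 0 = 0" for n
    by (rule clinear_on_zero[OF lin1 sub] clinear_on_zero[OF lin2 sub] clinear_on_zero[OF A_linear sub])+
  have cancel: "v = 0" if "cinner g g *\<^sub>C v = 0" for v :: "'c::complex_inner"
    using that \<open>g \<noteq> 0\<close> cinner_eq_zero_iff[of g] norm_scaleC[of "cinner g g" v] by simp
  have "C1 g = 0" using eq[of 0 g] by (simp add: Pg zero)
  then show "\<omega>1 a = k1" using cancel[of v1] by (simp add: C1_def Pg zero v1_def)
  \<comment> \<open>Coefficient \<open>Suc n\<close> at \<open>g\<close> is coefficient
    \<open>n\<close> at \<open>C2 g\<close>, and \<open>C2 g\<close> is a nonzero multiple of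
    \<open>v2\<close>.\<close>
  have "A n (P (C2 g)) = A (Suc n) (P g)"
    using eq[of n "C2 g"] eq[of "Suc n" g] by (simp add: funpow_swap1)
  then have "cinner g g *\<^sub>C A n (P v2) = 0"
    by (simp add: C2_def Pg zero proj_scaleC A_scaleC)
  then show "A n (P (k2 - \<omega>2 a)) = 0" using cancel v2_def by blast
qed

lemma unique_solution_imp_coisometry:
  assumes uniq: "unique_solution" and F: "F \<noteq> UNIV"
  shows "coisometry_on F (A n)"
proof -
  obtain B1 B2 where B1: "\<And>y. B1 y \<in> F" "\<And>x y. x \<in> F \<Longrightarrow> cinner (\<omega>1 x) y = cinner x (B1 y)"
    and B2: "\<And>u. B2 u \<in> F" "\<And>x u. x \<in> F \<Longrightarrow> cinner (\<omega>2 x) u = cinner x (B2 u)"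
    by (rule adjoints) blast
  \<comment> \<open>The defect lemma is used for the vectors \<open>(y, 0)\<close> and
    \<open>(0, u)\<close>, on which the adjoint of the data takes the values \<open>B1 y\<close> and
    \<open>B2 u\<close>.\<close>
  have k1: "\<omega>1 (B1 y) = y" for y
    by (rule unique_solution_kills_defect(1)[OF uniq F, where ?k2.0 = 0]) (auto simp: B1)
  have k2: "A n (P (u - \<omega>2 (B2 u))) = 0" for n u
    by (rule unique_solution_kills_defect(2)[OF uniq F, where ?k1.0 = 0]) (auto simp: B2)
  have shift: "A (Suc n) (B2 u) = A n (P u)" for n u
  proof -
    have "P u = P (u - \<omega>2 (B2 u)) + P (\<omega>2 (B2 u))" by (simp add: proj_add[symmetric])
    then show ?thesis using k2[of n u] by (simp add: A_add A_Suc)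
  qed
  show ?thesis
  proof (induction n)
    case 0
    show ?case unfolding coisometry_on_def
      by (rule exI[of _ B1]) (auto simp: A_0 B1 k1)
  next
    case (Suc n)
    then obtain B where B: "\<And>y. B y \<in> F" "\<And>x y. x \<in> F \<Longrightarrow> cinner (A n x) y = cinner x (B y)"
      "\<And>y. A n (B y) = y"
      by (auto simp: coisometry_on_def)
    have "cinner (P (\<omega>2 x)) (B y) = cinner (\<omega>2 x) (B y)" for x y
      using cinner_proj[OF B(1), of y "\<omega>2 x"] by (metis cinner_commute)
    then have "cinner (A (Suc n) x) y = cinner x (B2 (B y))" if "x \<in> F" for x y
      using that by (simp add: A_Suc B B2)
    then show ?case unfolding coisometry_on_def
      by (intro exI[of _ "\<lambda>y. B2 (B y)"]) (auto simp: B2 shift proj_id B)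
  qed
qed

section \<open>Sufficiency and the equivalence\<close>

lemma solution_coeffs_of_coisometry:
  assumes "H2_interp_solution F \<omega>1 \<omega>2 H"
    and co: "F = UNIV \<or> (\<forall>n. coisometry_on F (A n))"
  shows "H2_coeffs (\<lambda>z. H z u) (\<lambda>n. A n (P u))"
proof -
  have "H \<in> H2_ball" using assms(1) by (simp add: H2_interp_solution_def)
  then obtain h where h: "\<And>u. H2_coeffs (\<lambda>z. H z u) (\<lambda>n. h n u)"
    "\<And>n. clinear_on UNIV (h n)" "\<And>n u. norm (h n u) \<le> norm u"
    by (rule H2_ball_coeffs) blast
  have rec: "h 0 x = \<omega>1 x" "h (Suc n) x = h n (\<omega>2 x)" if "x \<in> F" for x n
    using assms(1) that interpolation_iff_coeffs[of H h F \<omega>1 \<omega>2, OF h(1)]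
    by (auto simp: H2_interp_solution_def)
  have "h n u = A n (P u)" for n u
  proof (induction n arbitrary: u)
    case 0
    have "h 0 x = A 0 x" if "x \<in> F" for x using that by (simp add: rec A_0)
    with co show ?case
      using contraction_vanishes_off_coisometry[OF h(2,3)] by (metis UNIV_I proj_id)
  next
    case (Suc n)
    \<comment> \<open>The induction hypothesis must hold on the whole space, because
      \<open>\<omega>2 x\<close> may leave \<open>F\<close>. Off \<open>F\<close>, either
      co-isometry forces the values or \<open>F = UNIV\<close> leaves nothing to determine.\<close>
    have "h (Suc n) x = A (Suc n) x" if "x \<in> F" for x using that by (simp add: rec A_Suc Suc.IH)
    with co show ?case
      using contraction_vanishes_off_coisometry[OF h(2,3)] by (metis UNIV_I proj_id)
  qed
  then show ?thesis using h(1)[of u] by simp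
qed

lemma unique_solution_iff:
  "unique_solution \<longleftrightarrow> F = UNIV \<or> (\<forall>n. coisometry_on F (A n))"
proof
  assume "unique_solution"
  then show "F = UNIV \<or> (\<forall>n. coisometry_on F (A n))"
    using unique_solution_imp_coisometry by blast
next
  assume co: "F = UNIV \<or> (\<forall>n. coisometry_on F (A n))"
  obtain H where H: "H2_interp_solution F \<omega>1 \<omega>2 H"
    using central_solution(1) by (auto simp: proj_id)
  have "H' z = H z" if "H2_interp_solution F \<omega>1 \<omega>2 H'" "cmod z < 1" for H' z
  proof
    fix u
    show "H' z u = H z u"
      using solution_coeffs_of_coisometry[OF that(1) co, of u] solution_coeffs_of_coisometry[OF H co, of u]
        that(2) unfolding H2_coeffs_def by (blast intro: sums_unique2)
  qed
  with H show "unique_solution" unfolding unique_solution_def by blast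
qed

end

theorem theorem0p2:
  fixes F :: "'u::chilbert_space set"
    and \<omega>1 :: "'u \<Rightarrow> 'y::chilbert_space"
    and \<omega>2 :: "'u \<Rightarrow> 'u"
  assumes F: "closed_csubspace F"
    and lin1: "clinear_on F \<omega>1"
    and lin2: "clinear_on F \<omega>2"
    and contr: "\<forall>x\<in>F. (norm (\<omega>1 x))\<^sup>2 + (norm (\<omega>2 x))\<^sup>2 \<le> (norm x)\<^sup>2"
  shows "(\<exists>H. H2_interp_solution F \<omega>1 \<omega>2 H \<and>
            (\<forall>H'. H2_interp_solution F \<omega>1 \<omega>2 H' \<longrightarrow> (\<forall>z. cmod z < 1 \<longrightarrow> H' z = H z)))
         \<longleftrightarrow> (F = UNIV \<or>
              (\<forall>n::nat. coisometry_on F (\<omega>1 \<circ> ((\<lambda>x. orth_proj F (\<omega>2 x)) ^^ n))))"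
proof -
  interpret interpolation_data F \<omega>1 \<omega>2
    by unfold_locales (use assms in auto)
  show ?thesis using unique_solution_iff unfolding unique_solution_def A_def .
qed

end
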